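(* Let $\|\cdot\|$ be a norm on $\mathbb{R}^n$ with dual norm $\|\cdot\|_*$, and let $1\le\tau<M\le T$ be integers with $M$ dividing $T$. Let $\mathcal{W}\subset\mathbb{R}^n$ be a convex set, and let $\psi$ be a mirror map that is $1$-strongly convex with respect to $\|\cdot\|$, such that $\triangle_\psi(w,v)\le B^2$ for all $w,v\in\mathcal{W}$, where $\triangle_\psi$ is the Bregman divergence of $\psi$. Let $h_1,\ldots,h_T:\mathcal{W}\to\mathbb{R}$ be convex losses chosen in advance (obliviously), such that for every $w\in\mathcal{W}$ and every $t$ the (sub)gradient satisfies $\|\nabla h_t(w)\|_*\le G$. Suppose the Delayed Permuted Mirror Descent algorithm (defined in the context) is run with delay parameter $\tau$, block size $M$ and step sizes $\eta_f,\eta_s$. Let $f_1,\ldots,f_T$ be the randomly permuted losses, let $w_t$ be the prediction at round $t$, and let $w^*\in\operatorname{argmin}_{w\in\mathcal{W}}\sum_{t=1}^T f_t(w)$. Let $\Psi_{(\eta_f,G)}$ be an upper bound on the distance $\|w_{j+1}-w_j\|$ between any two consecutive predictors, where $w_{j+1}$ is obtained from $w_j$ by one mirror descent update with step size $\eta_f$ and a gradient $g$ with $\|g\|_*\le G$. Then the expected regret satisfies $$\mathbb{E}\left[\sum_{t=1}^{T} f_t(w_t)-f_t(w^* )\right]\le \frac{B^2}{\eta_f}+\eta_f\cdot\frac{T\tau}{M}\cdot\frac{G^2}{2}+\frac{T\tau^2}{M}\cdot G\cdot\Psi_{(\eta_f,G)}+\frac{B^2}{\eta_s}+\eta_s\cdot\frac{T(M-\tau)}{M}\cdot\frac{G^2}{2}.$$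 Furthermore, if $\Psi_{(\eta_f,G)}\le c\cdot\eta_f G$ for some constant $c$, and $$\eta_f=\frac{B\sqrt{M}}{G\sqrt{T\tau\left(\frac12+c\tau\right)}},\qquad \eta_s=\frac{B\sqrt{2M}}{G\sqrt{T(M-\tau)}},$$ then the expected regret is bounded by $$c\sqrt{\frac{T\tau}{M}}\cdot BG\sqrt{\frac12+c\tau}+\sqrt{\frac{2T(M-\tau)}{M}}\cdot BG=\mathcal{O}\left(\sqrt{T}\left(\sqrt{\frac{\tau^2}{M}}+1\right)\right),$$ where in the $\mathcal{O}$ notation $B,G,c$ are treated as constants.
   Context: **Setting (Online Learning with Local Permutations, delayed feedback).** An oblivious adversary fixes convex losses $h_1,\ldots,h_T:\mathcal{W}\to\mathbb{R}$. Before any loss is revealed, the learner may choose a (possibly random) permutation $\sigma$ of $\{1,\ldots,T\}$ with $|\sigma(t)-t|\le M$ for all $t$. The learner then faces the sequence $f_t=h_{\sigma^{-1}(t)}$. At each round $t$ the learner makes a prediction $w_t$, suffers the loss $f_t(w_t)$, and gets to observe only the function $f_{t-\tau}$ (nothing if no such function exists). $\nabla h_t(w)$ denotes the gradient, or a subgradient, of $h_t$ at $w$; correspondingly $\nabla f_t=\nabla h_{\sigma^{-1}(t)}$. The expected regret is $\mathbb{E}[\sum_{t=1}^T f_t(w_t)-f_t(w^* )]$, the expectation being over the randomness of the algorithm (the random permutation). **Mirror map and mirror descent update.** A mirror map $\psi$ is a strictly convex, continuously differentiable function. Its Bregman divergence is $\triangle_\psi(x,y)=\psi(x)-\psi(y)-\langle\nabla\psi(y),x-y\rangle$.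 The mirror descent update from $w$ with step size $\eta$ and gradient $g$ is: let $w_{1/2}$ be the point with $\nabla\psi(w_{1/2})=\nabla\psi(w)-\eta g$ (equivalently $w_{1/2}=(\nabla\psi^* )(\nabla\psi(w)-\eta g)$, with $\psi^*$ the dual function of $\psi$), and output $w'=\operatorname{argmin}_{u\in\mathcal{W}}\triangle_\psi(u,w_{1/2})$. $1$-strong convexity with respect to $\|\cdot\|$ means $\psi(x)\ge\psi(y)+\langle\nabla\psi(y),x-y\rangle+\frac12\|x-y\|^2$. **Delayed Permuted Mirror Descent algorithm** (inputs $M,\eta_f,\eta_s$). - Divide $\{1,\ldots,T\}$ into consecutive blocks of size $M$, and permute the losses uniformly at random within each block. Let $f_1,\ldots,f_T$ be the resulting sequence. - Let $T_1(1)<T_1(2)<\cdots$ enumerate the rounds that are among the first $\tau$ rounds of their block, and let $T_2(1)<T_2(2)<\cdots$ enumerate the rounds that are among the first $M-\tau$ rounds of their block. - Two predictor sequences $w^f_1,w^f_2,\ldots$ and $w^s_1,w^s_2,\ldots$ are maintained, initialized at $w^f_1=0$ and $w^s_1=0$, with counters $j_f=j_s=1$. - At round $t$, if $t$ is among the first $\tau$ rounds of its block: predict $w_t=w^f_{j_f}$; let $g=\nabla f_{T_1(j_f-\tau)}(w^f_{j_f-\tau})$, where $T_1(j_f-\tau)=t-M$ (if no such loss exists, i.e. in the first $\tau$ rounds, take the zero function, so $g=0$); let $w^f_{j_f+1}$ be the mirror descent update from $w^f_{j_f}$ with step size $\eta_f$ and gradient $g$; increment $j_f$. - Otherwise: predict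 $w_t=w^s_{j_s}$; let $g=\nabla f_{t-\tau}(w^s_{j_s})$, where $t-\tau=T_2(j_s)$; let $w^s_{j_s+1}$ be the mirror descent update from $w^s_{j_s}$ with step size $\eta_s$ and gradient $g$; increment $j_s$.
   Formalization: The printed tuned bound with leading factor c fails for small c (e.g. c = 1); it is proved with factor 2 for every c and as printed for c ≥ 2. It is also assumed that 0 lies in W, that the mirror descent updates exist, and that the step sizes are positive. *)

theory Defs
  imports
    "HOL-Probability.Probability"
    "HOL-Combinatorics.Permutations"
    "HOL-Library.Infinite_Set"
    "HOL-Library.Landau_Symbols"
begin

definition is_norm :: "('a::real_vector \<Rightarrow> real) \<Rightarrow> bool" where
  "is_norm N \<longleftrightarrow>
     (\<forall>x. 0 \<le> N x) \<and> (\<forall>x. N x = 0 \<longleftrightarrow> x = 0) \<and>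
     (\<forall>a x. N (a *\<^sub>R x) = \<bar>a\<bar> * N x) \<and> (\<forall>x y. N (x + y) \<le> N x + N y)"

definition dual_norm :: "('a::real_inner \<Rightarrow> real) \<Rightarrow> 'a \<Rightarrow> real" where
  "dual_norm N g = (SUP x\<in>{x. N x \<le> 1}. g \<bullet> x)"

definition grad :: "('a::real_inner \<Rightarrow> real) \<Rightarrow> 'a \<Rightarrow> 'a" where
  "grad f x = (THE d. GDERIV f x :> d)"

definition is_subgradient_on :: "'a::real_inner set \<Rightarrow> ('a \<Rightarrow> real) \<Rightarrow> 'a \<Rightarrow> 'a \<Rightarrow> bool" where
  "is_subgradient_on W f w g \<longleftrightarrow> (\<forall>u\<in>W. f w + g \<bullet> (u - w) \<le> f u)"

definition strictly_convex_on :: "'a::real_vector set \<Rightarrow> ('a \<Rightarrow> real) \<Rightarrow> bool" where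
  "strictly_convex_on D f \<longleftrightarrow> convex D \<and>
     (\<forall>x\<in>D. \<forall>y\<in>D. \<forall>u. x \<noteq> y \<and> 0 < u \<and> u < 1 \<longrightarrow>
        f ((1 - u) *\<^sub>R x + u *\<^sub>R y) < (1 - u) * f x + u * f y)"

(* D is the (open) domain of the mirror map; D = UNIV is allowed. *)
definition mirror_map :: "'a::real_inner set \<Rightarrow> ('a \<Rightarrow> real) \<Rightarrow> bool" where
  "mirror_map D \<psi> \<longleftrightarrow> open D \<and> strictly_convex_on D \<psi> \<and>
     (\<forall>x\<in>D. \<psi> differentiable (at x)) \<and> continuous_on D (grad \<psi>)"

definition one_strongly_convex_on ::
  "('a::real_inner \<Rightarrow> real) \<Rightarrow> 'a set \<Rightarrow> ('a \<Rightarrow> real) \<Rightarrow> bool" where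
  "one_strongly_convex_on N S \<psi> \<longleftrightarrow>
     (\<forall>x\<in>S. \<forall>y\<in>S. \<psi> y + grad \<psi> y \<bullet> (x - y) + 1 / 2 * (N (x - y))\<^sup>2 \<le> \<psi> x)"

definition bregman :: "('a::real_inner \<Rightarrow> real) \<Rightarrow> 'a \<Rightarrow> 'a \<Rightarrow> real" where
  "bregman \<psi> x y = \<psi> x - \<psi> y - grad \<psi> y \<bullet> (x - y)"

(* w' is the result of the mirror descent update from w with gradient g; y is the
   intermediate point w_{1/2}. By strict convexity of \<psi>, both y and w' are unique. *)
definition md_update ::
  "'a::real_inner set \<Rightarrow> ('a \<Rightarrow> real) \<Rightarrow> 'a set \<Rightarrow> real \<Rightarrow> 'a \<Rightarrow> 'a \<Rightarrow> 'a \<Rightarrow> bool" where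
  "md_update D \<psi> W \<eta> w g w' \<longleftrightarrow>
     (\<exists>y\<in>D. grad \<psi> y = grad \<psi> w - \<eta> *\<^sub>R g \<and>
        is_arg_min (\<lambda>u. bregman \<psi> u y) (\<lambda>u. u \<in> W) w')"

definition md_step ::
  "'a::real_inner set \<Rightarrow> ('a \<Rightarrow> real) \<Rightarrow> 'a set \<Rightarrow> real \<Rightarrow> 'a \<Rightarrow> 'a \<Rightarrow> 'a" where
  "md_step D \<psi> W \<eta> w g = (SOME w'. md_update D \<psi> W \<eta> w g w')"

(* Rounds, losses, blocks and predictors are numbered from 0: the rounds are 0, ..., T - 1,
   and round t is at position t mod M of block t div M. *)

(* first_rounds M k 0 < first_rounds M k 1 < ... are the rounds that are among the first k
   of their block: T_1 is first_rounds M \<tau>, and T_2 is first_rounds M (M - \<tau>). *)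
definition first_rounds :: "nat \<Rightarrow> nat \<Rightarrow> nat \<Rightarrow> nat" where
  "first_rounds M k = enumerate {t. t mod M < k}"

(* The uniform distribution on this set permutes every block uniformly and independently.
   A permutation maps the original index of a loss to the round at which it is played. *)
definition block_perms :: "nat \<Rightarrow> nat \<Rightarrow> (nat \<Rightarrow> nat) set" where
  "block_perms T M = {\<sigma>. \<sigma> permutes {..<T} \<and> (\<forall>t<T. \<sigma> t div M = t div M)}"

definition permuted :: "(nat \<Rightarrow> 'b) \<Rightarrow> (nat \<Rightarrow> nat) \<Rightarrow> nat \<Rightarrow> 'b" where
  "permuted h \<sigma> t = h (inv \<sigma> t)"

(* In fast_pred and slow_pred, U w g is the mirror descent update from w with gradient g
   (for the respective step size), and df t is the (sub)gradient of f_t. *)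
fun fast_pred ::
  "('a::zero \<Rightarrow> 'a \<Rightarrow> 'a) \<Rightarrow> (nat \<Rightarrow> 'a \<Rightarrow> 'a) \<Rightarrow> nat \<Rightarrow> nat \<Rightarrow> nat \<Rightarrow> 'a" where
  "fast_pred U df \<tau> M 0 = 0"
| "fast_pred U df \<tau> M (Suc j) =
     U (fast_pred U df \<tau> M j)
       (if \<tau> \<le> j then df (first_rounds M \<tau> (j - \<tau>)) (fast_pred U df \<tau> M (j - \<tau>)) else 0)"

fun slow_pred ::
  "('a::zero \<Rightarrow> 'a \<Rightarrow> 'a) \<Rightarrow> (nat \<Rightarrow> 'a \<Rightarrow> 'a) \<Rightarrow> nat \<Rightarrow> nat \<Rightarrow> nat \<Rightarrow> 'a" where
  "slow_pred U df \<tau> M 0 = 0"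
| "slow_pred U df \<tau> M (Suc j) =
     U (slow_pred U df \<tau> M j)
       (df (first_rounds M (M - \<tau>) j) (slow_pred U df \<tau> M j))"

(* Each counter is incremented once per round of its kind, so at round t it equals the
   number of earlier rounds of that kind. *)
definition dpmd_prediction ::
  "'a::real_inner set \<Rightarrow> ('a \<Rightarrow> real) \<Rightarrow> 'a set \<Rightarrow> real \<Rightarrow> real \<Rightarrow> nat \<Rightarrow> nat \<Rightarrow>
   (nat \<Rightarrow> 'a \<Rightarrow> 'a) \<Rightarrow> nat \<Rightarrow> 'a" where
  "dpmd_prediction D \<psi> W \<eta>f \<eta>s \<tau> M df t =
     (if t mod M < \<tau>
      then fast_pred (md_step D \<psi> W \<eta>f) df \<tau> M (card {s. s < t \<and> s mod M < \<tau>})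
      else slow_pred (md_step D \<psi> W \<eta>s) df \<tau> M (card {s. s < t \<and> \<tau> \<le> s mod M}))"

(* h: the losses, dh: their (sub)gradients, ws \<sigma>: the comparator for the permutation \<sigma>. *)
definition dpmd_expected_regret ::
  "'a::real_inner set \<Rightarrow> ('a \<Rightarrow> real) \<Rightarrow> 'a set \<Rightarrow> real \<Rightarrow> real \<Rightarrow> nat \<Rightarrow> nat \<Rightarrow> nat \<Rightarrow>
   (nat \<Rightarrow> 'a \<Rightarrow> real) \<Rightarrow> (nat \<Rightarrow> 'a \<Rightarrow> 'a) \<Rightarrow> ((nat \<Rightarrow> nat) \<Rightarrow> 'a) \<Rightarrow> real" where
  "dpmd_expected_regret D \<psi> W \<eta>f \<eta>s \<tau> M T h dh ws =
     measure_pmf.expectation (pmf_of_set (block_perms T M))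
       (\<lambda>\<sigma>. \<Sum>t<T.
          permuted h \<sigma> t (dpmd_prediction D \<psi> W \<eta>f \<eta>s \<tau> M (permuted dh \<sigma>) t)
          - permuted h \<sigma> t (ws \<sigma>))"

(* Substituting the tuned step sizes in the general regret bound gives k = 2. With k = c the
   bound can fail for c < 2. *)
definition tuned_bound :: "real \<Rightarrow> real \<Rightarrow> real \<Rightarrow> real \<Rightarrow> nat \<Rightarrow> nat \<Rightarrow> nat \<Rightarrow> real" where
  "tuned_bound k c B G T \<tau> M =
     k * sqrt (real T * real \<tau> / real M) * (B * G * sqrt (1 / 2 + c * real \<tau>))
     + sqrt (2 * real T * (real M - real \<tau>) / real M) * (B * G)"

end

(* Fast predictors follow mirror descent with gradients delayed by \<tau> of their own steps; replacing
   w_j by w_(j + \<tau>) in the linearised regret costs at most \<tau> * G * \<Psi> per round and leaves the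
   regret of undelayed mirror descent. A slow predictor is played against the loss of round a + \<tau>
   but updated with the loss of round a of the same block. Since it depends only on losses before
   round a, exchanging the losses of rounds a and a + \<tau> preserves the uniform distribution and the
   predictor, so in expectation the slow predictors suffer the loss they are updated with. *)

theory Submission
  imports Defs
begin

text \<open>In the first \<open>\<tau>\<close> rounds of a block, the latest observed loss belongs
  to an earlier block, and permutations act only within blocks, so it cannot be exchanged with the
  loss being played. Hence the separate fast sequence, which is analysed for each fixed permutation.
  Only \<open>T * \<tau> / M\<close> rounds are of this kind, so the delay costs
  \<open>T * \<tau>^2 / M * G * \<Psi>\<close> in total. The exchange is an identity between sums
  over all permutations, not one that holds permutation by permutation. It is carried out on the
  losses, before linearisation. What is left is bounded uniformly over all permutations.\<close>

section \<open>Gradients, norms and dual norms\<close>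

text \<open>\<open>grad\<close> is a definite description, so existence and uniqueness of the
  gradient have to be shown. The values of the derivative on the basis give the vector
  \<open>d\<close> that represents it.\<close>

lemma gderiv_grad:
  fixes f :: "'a::euclidean_space \<Rightarrow> real"
  assumes "f differentiable (at x)"
  shows "GDERIV f x :> grad f x"
proof -
  obtain f' where f': "(f has_derivative f') (at x)"
    using assms by (auto simp: differentiable_def)
  define d where "d = (\<Sum>b\<in>Basis. f' b *\<^sub>R b)"
  have lin: "linear f'"
    using f' by (rule has_derivative_linear)
  have "f' = (\<lambda>y. y \<bullet> d)"
  proof
    fix y
    have "f' y = f' (\<Sum>b\<in>Basis. (y \<bullet> b) *\<^sub>R b)"
      by (simp add: euclidean_representation)
    also have "\<dots> = y \<bullet> d"
      by (simp add: d_def linear_sum[OF lin] linear_cmul[OF lin] inner_sum_right mult.commute)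
    finally show "f' y = y \<bullet> d" .
  qed
  then have d: "GDERIV f x :> d"
    using f' by (simp add: gderiv_def)
  have "e = d" if "GDERIV f x :> e" for e
  proof -
    have "(\<lambda>y. y \<bullet> e) = (\<lambda>y. y \<bullet> d)"
      using that d unfolding gderiv_def by (rule has_derivative_unique)
    then have "\<forall>y. y \<bullet> e = y \<bullet> d"
      by (simp add: fun_eq_iff)
    then show "e = d"
      by (simp only: vector_eq_ldot)
  qed
  with d show ?thesis
    unfolding grad_def by (rule theI)
qed

lemma
  assumes "is_norm N"
  shows is_norm_nonneg: "0 \<le> N x"
    and is_norm_eq_zero_iff: "N x = 0 \<longleftrightarrow> x = 0"
    and is_norm_scaleR: "N (a *\<^sub>R x) = \<bar>a\<bar> * N x"
    and is_norm_triangle: "N (x + y) \<le> N x + N y"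
  using assms unfolding is_norm_def by blast+

lemma is_norm_zero: "is_norm N \<Longrightarrow> N 0 = 0"
  by (simp add: is_norm_eq_zero_iff)

lemma is_norm_pos: "is_norm N \<Longrightarrow> x \<noteq> 0 \<Longrightarrow> 0 < N x"
  using is_norm_nonneg[of N x] is_norm_eq_zero_iff[of N x] by simp

lemma is_norm_minus_commute:
  assumes "is_norm N"
  shows "N (x - y) = N (y - x)"
  using is_norm_scaleR[OF assms, of "- 1" "y - x"] by simp

text \<open>Half of the equivalence of norms in finite dimension: \<open>N\<close> is convex, hence
  continuous, and attains a positive minimum on the compact Euclidean unit sphere.\<close>

lemma is_norm_dominates_norm:
  fixes N :: "'a::euclidean_space \<Rightarrow> real"
  assumes N: "is_norm N"
  shows "\<exists>m>0. \<forall>x. m * norm x \<le> N x"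
proof -
  have "convex_on UNIV N"
  proof (rule convex_onI)
    fix t :: real and x y :: 'a
    assume "0 < t" "t < 1"
    then show "N ((1 - t) *\<^sub>R x + t *\<^sub>R y) \<le> (1 - t) * N x + t * N y"
      using is_norm_triangle[OF N, of "(1 - t) *\<^sub>R x" "t *\<^sub>R y"]
      by (simp add: is_norm_scaleR[OF N])
  qed simp
  then have "continuous_on UNIV N"
    by (simp add: convex_on_continuous)
  then have "continuous_on (sphere 0 1) N"
    using continuous_on_subset by blast
  moreover obtain b :: 'a where "b \<in> Basis"
    using nonempty_Basis by blast
  then have "sphere (0::'a) 1 \<noteq> {}"
    by (auto intro!: exI[of _ b])
  ultimately obtain x0 where x0: "x0 \<in> sphere 0 1" "\<forall>x\<in>sphere 0 1. N x0 \<le> N x"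
    using continuous_attains_inf[of "sphere (0::'a) 1" N] by auto
  have "0 < N x0"
    using x0(1) by (intro is_norm_pos[OF N]) auto
  moreover have "N x0 * norm x \<le> N x" for x
  proof (cases "x = 0")
    case False
    then have "N x0 \<le> N (x /\<^sub>R norm x)"
      using x0(2) by simp
    also have "\<dots> = N x / norm x"
      by (simp add: is_norm_scaleR[OF N] divide_inverse_commute)
    finally show ?thesis
      using False by (simp add: field_simps)
  qed (simp add: is_norm_zero[OF N])
  ultimately show ?thesis
    by blast
qed

text \<open>Rescaling \<open>x\<close> to \<open>N\<close>-norm one reduces this to the definition
  of the supremum. A real \<open>SUP\<close> is an upper bound only over a set bounded above;
  comparison with the Euclidean norm supplies the bound \<open>norm g / m\<close>.\<close>

lemma inner_le_dual_norm:
  fixes N :: "'a::euclidean_space \<Rightarrow> real"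
  assumes N: "is_norm N"
  shows "g \<bullet> x \<le> dual_norm N g * N x"
proof (cases "x = 0")
  case False
  then have pos: "0 < N x"
    by (rule is_norm_pos[OF N])
  obtain m where m: "0 < m" "\<And>x. m * norm x \<le> N x"
    using is_norm_dominates_norm[OF N] by blast
  have "g \<bullet> y \<le> norm g / m" if "N y \<le> 1" for y
  proof -
    have "norm y \<le> 1 / m"
      using m(1) m(2)[of y] that by (simp add: field_simps)
    then have "norm g * norm y \<le> norm g * (1 / m)"
      by (rule mult_left_mono) simp
    then show ?thesis
      using norm_cauchy_schwarz[of g y] by simp
  qed
  then have "bdd_above ((\<bullet>) g ` {x. N x \<le> 1})"
    by (intro bdd_aboveI2[where M = "norm g / m"]) auto
  moreover have "N (x /\<^sub>R N x) \<le> 1"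
    using pos by (simp add: is_norm_scaleR[OF N])
  ultimately have "g \<bullet> (x /\<^sub>R N x) \<le> dual_norm N g"
    unfolding dual_norm_def by (intro cSUP_upper) auto
  then show ?thesis
    using pos by (simp add: field_simps)
qed (simp add: is_norm_zero[OF N])

text \<open>A negative value is refuted by testing on a basis vector and on its negative. This is
  what yields \<open>0 \<le> G\<close> from the gradient bound.\<close>

lemma dual_norm_nonneg:
  fixes N :: "'a::euclidean_space \<Rightarrow> real"
  assumes N: "is_norm N"
  shows "0 \<le> dual_norm N g"
proof -
  obtain b :: 'a where "b \<in> Basis"
    using nonempty_Basis by blast
  then have "0 < N b"
    by (intro is_norm_pos[OF N]) auto
  moreover have "N (- b) = N b"
    using is_norm_minus_commute[OF N, of 0 b] by simp
  ultimately show ?thesis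
    using inner_le_dual_norm[OF N, of g b] inner_le_dual_norm[OF N, of g "- b"]
    by (smt (verit) inner_minus_right mult_neg_pos)
qed

text \<open>The first \<open>\<tau>\<close> fast updates use the zero gradient, which must also
  respect the bound \<open>G\<close>.\<close>

lemma dual_norm_zero:
  assumes "is_norm N"
  shows "dual_norm N 0 = 0"
proof -
  have "{x. N x \<le> 1} \<noteq> {}"
    using is_norm_zero[OF assms] by (auto intro: exI[of _ 0])
  then show ?thesis
    by (simp add: dual_norm_def)
qed

section \<open>Mirror descent\<close>

text \<open>First-order optimality: if the derivative at \<open>w\<close> towards \<open>u\<close>
  were negative, a short move along the segment would stay in \<open>W\<close> and decrease
  \<open>F\<close>.\<close>

lemma convex_arg_min_gderiv:
  assumes "convex W" "is_arg_min F (\<lambda>u. u \<in> W) w" "u \<in> W" "GDERIV F w :> d"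
  shows "0 \<le> d \<bullet> (u - w)"
proof (rule ccontr)
  assume neg: "\<not> 0 \<le> d \<bullet> (u - w)"
  define p where "p s = w + s *\<^sub>R (u - w)" for s
  have w: "w \<in> W" and min: "\<And>v. v \<in> W \<Longrightarrow> F w \<le> F v"
    using assms(2) by (auto simp: is_arg_min_linorder)
  have "(p has_derivative (\<lambda>s. s *\<^sub>R (u - w))) (at 0)"
    unfolding p_def by (auto intro!: derivative_eq_intros)
  moreover have "(F has_derivative (\<lambda>y. y \<bullet> d)) (at (p 0))"
    using assms(4) by (simp add: gderiv_def p_def)
  ultimately have "(F \<circ> p has_derivative (\<lambda>y. y \<bullet> d) \<circ> (\<lambda>s. s *\<^sub>R (u - w))) (at 0)"
    by (rule diff_chain_at)
  then have "((F \<circ> p) has_real_derivative d \<bullet> (u - w)) (at 0)"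
    by (simp add: has_field_derivative_def o_def inner_commute mult.commute[of _ "d \<bullet> (u - w)"])
  then obtain e where e: "0 < e" "\<And>s. 0 < s \<Longrightarrow> s < e \<Longrightarrow> (F \<circ> p) (0 + s) < (F \<circ> p) 0"
    using DERIV_neg_dec_right[of "F \<circ> p" "d \<bullet> (u - w)" 0] neg by auto
  \<comment> \<open>Below \<open>e\<close>, to lie in the range of decrease; at most 1, to stay on
    the segment.\<close>
  define s where "s = min (e / 2) 1"
  have s: "0 < s" "s < e" "s \<le> 1"
    using e(1) by (auto simp: s_def)
  have "p s = (1 - s) *\<^sub>R w + s *\<^sub>R u"
    by (simp add: p_def algebra_simps)
  then have "p s \<in> W"
    using assms(1,3) w s by (auto intro!: convexD)
  then have "F w \<le> F (p s)"
    by (rule min)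
  with e(2)[OF s(1,2)] show False
    by (simp add: p_def)
qed

text \<open>One step size per instance: the locale is interpreted once for \<open>\<eta>f\<close>
  and once for \<open>\<eta>s\<close>. \<open>updates_exist\<close> makes the choice in
  \<open>md_step\<close> meaningful. Strong convexity and the Bregman bound are asked on
  \<open>W\<close> only, because the intermediate point of an update enters the analysis only
  through its gradient.\<close>

locale mirror_descent =
  fixes N :: "'a::euclidean_space \<Rightarrow> real" and D W :: "'a set" and \<psi> :: "'a \<Rightarrow> real"
    and \<eta> B G :: real
  assumes norm: "is_norm N"
    and step_size: "0 < \<eta>"
    and convex_W: "convex W" and W_sub: "W \<subseteq> D"
    and differentiable: "\<And>x. x \<in> D \<Longrightarrow> \<psi> differentiable (at x)"
    and strongly_convex: "one_strongly_convex_on N W \<psi>"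
    and bregman_bound: "\<And>w v. w \<in> W \<Longrightarrow> v \<in> W \<Longrightarrow> bregman \<psi> w v \<le> B\<^sup>2"
    and updates_exist:
      "\<And>w g. w \<in> W \<Longrightarrow> dual_norm N g \<le> G \<Longrightarrow> \<exists>w'. md_update D \<psi> W \<eta> w g w'"
begin

lemma md_update_step:
  assumes "w \<in> W" "dual_norm N g \<le> G"
  shows "md_update D \<psi> W \<eta> w g (md_step D \<psi> W \<eta> w g)"
  unfolding md_step_def using updates_exist[OF assms] by (rule someI_ex)

lemma md_update_in: "md_update D \<psi> W \<eta> w g w' \<Longrightarrow> w' \<in> W"
  by (auto simp: md_update_def is_arg_min_def)

lemma bregman_lower:
  assumes "u \<in> W" "v \<in> W"
  shows "1 / 2 * (N (u - v))\<^sup>2 \<le> bregman \<psi> u v"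
  using strongly_convex assms unfolding one_strongly_convex_on_def bregman_def
  by (auto simp: algebra_simps)

text \<open>The one-step inequality of mirror descent: optimality of \<open>w'\<close> controls the
  part \<open>g \<bullet> (w' - u)\<close>, and the remaining \<open>g \<bullet> (w - w')\<close> is
  paid for by strong convexity.\<close>

lemma md_update_progress:
  assumes w: "w \<in> W" and u: "u \<in> W" and g: "dual_norm N g \<le> G"
    and up: "md_update D \<psi> W \<eta> w g w'"
  shows "\<eta> * (g \<bullet> (w - u)) \<le> bregman \<psi> u w - bregman \<psi> u w' + \<eta>\<^sup>2 * G\<^sup>2 / 2"
proof -
  obtain y where y: "grad \<psi> y = grad \<psi> w - \<eta> *\<^sub>R g"
    and argmin: "is_arg_min (\<lambda>u. bregman \<psi> u y) (\<lambda>u. u \<in> W) w'"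
    using up by (auto simp: md_update_def)
  have w': "w' \<in> W"
    using up by (rule md_update_in)
  then have "GDERIV \<psi> w' :> grad \<psi> w'"
    using W_sub differentiable by (intro gderiv_grad) auto
  then have "GDERIV (\<lambda>u. bregman \<psi> u y) w' :> grad \<psi> w' - grad \<psi> y"
    unfolding bregman_def gderiv_def
    by (auto intro!: derivative_eq_intros simp: inner_diff_right inner_commute)
  from convex_arg_min_gderiv[OF convex_W argmin u this]
  have opt: "0 \<le> (grad \<psi> w' - grad \<psi> w) \<bullet> (u - w') + \<eta> * (g \<bullet> (u - w'))"
    by (simp add: y algebra_simps inner_diff_left inner_add_left)
  have "g \<bullet> (w - w') \<le> dual_norm N g * N (w - w')"
    by (rule inner_le_dual_norm[OF norm])
  also have "N (w - w') = N (w' - w)"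
    by (rule is_norm_minus_commute[OF norm])
  also have "dual_norm N g * N (w' - w) \<le> G * N (w' - w)"
    using g norm by (intro mult_right_mono) (auto simp: is_norm_nonneg)
  finally have "\<eta> * (g \<bullet> (w - w')) \<le> \<eta> * (G * N (w' - w))"
    using step_size by simp
  also have "\<dots> \<le> 1 / 2 * (N (w' - w))\<^sup>2 + \<eta>\<^sup>2 * G\<^sup>2 / 2"
    \<comment> \<open>Young's inequality; the factor 1/2 matches the one in strong convexity, so the
      quadratic term is absorbed by \<open>bregman \<psi> w' w\<close>.\<close>
    using zero_le_power2[of "N (w' - w) - \<eta> * G"] by (simp add: power2_eq_square algebra_simps)
  also have "\<dots> \<le> bregman \<psi> w' w + \<eta>\<^sup>2 * G\<^sup>2 / 2"
    using bregman_lower[OF w' w] by simp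
  finally have step: "\<eta> * (g \<bullet> (w - w')) \<le> bregman \<psi> w' w + \<eta>\<^sup>2 * G\<^sup>2 / 2" .
  \<comment> \<open>The three-point identity of Bregman divergences.\<close>
  have "bregman \<psi> u w - bregman \<psi> u w' = bregman \<psi> w' w + (grad \<psi> w' - grad \<psi> w) \<bullet> (u - w')"
    by (simp add: bregman_def algebra_simps inner_diff_left inner_diff_right)
  moreover have "\<eta> * (g \<bullet> (w - u)) = \<eta> * (g \<bullet> (w - w')) - \<eta> * (g \<bullet> (u - w'))"
    by (simp add: algebra_simps inner_diff_right)
  ultimately show ?thesis
    using opt step by linarith
qed

text \<open>The divergences to \<open>u\<close> telescope; the first is at most
  \<open>B\<^sup>2\<close> and the last is nonnegative. The gradients \<open>g\<close> are arbitrary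
  vectors, not tied to losses, so that the bound also applies to a shifted sequence.\<close>

lemma linear_regret:
  assumes w: "w 0 \<in> W" and u: "u \<in> W"
    and g: "\<And>j. j < n \<Longrightarrow> dual_norm N (g j) \<le> G"
    and up: "\<And>j. j < n \<Longrightarrow> md_update D \<psi> W \<eta> (w j) (g j) (w (Suc j))"
  shows "(\<Sum>j<n. g j \<bullet> (w j - u)) \<le> B\<^sup>2 / \<eta> + \<eta> * real n * (G\<^sup>2 / 2)"
proof -
  have in_W: "w j \<in> W" if "j \<le> n" for j
    using that w by (cases j) (auto intro: md_update_in[OF up])
  have "\<eta> * (\<Sum>j<k. g j \<bullet> (w j - u))
      \<le> bregman \<psi> u (w 0) - bregman \<psi> u (w k) + real k * (\<eta>\<^sup>2 * G\<^sup>2 / 2)" if "k \<le> n" for k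
    using that
  proof (induction k)
    case (Suc k)
    then have "\<eta> * (g k \<bullet> (w k - u))
        \<le> bregman \<psi> u (w k) - bregman \<psi> u (w (Suc k)) + \<eta>\<^sup>2 * G\<^sup>2 / 2"
      using in_W u g up by (intro md_update_progress) auto
    with Suc show ?case
      by (simp add: distrib_left distrib_right add_divide_distrib)
  qed simp
  from this[of n] have "\<eta> * (\<Sum>j<n. g j \<bullet> (w j - u))
      \<le> bregman \<psi> u (w 0) - bregman \<psi> u (w n) + real n * (\<eta>\<^sup>2 * G\<^sup>2 / 2)"
    by simp
  moreover have "0 \<le> bregman \<psi> u (w n)"
    using bregman_lower[OF u in_W[of n]] zero_le_power2[of "N (u - w n)"] by linarith
  ultimately have "\<eta> * (\<Sum>j<n. g j \<bullet> (w j - u)) \<le> B\<^sup>2 + real n * (\<eta>\<^sup>2 * G\<^sup>2 / 2)"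
    using bregman_bound[OF u w] by linarith
  then show ?thesis
    using step_size by (simp add: field_simps power2_eq_square)
qed

text \<open>The shifted sequence \<open>w (j + d)\<close> receives \<open>g j\<close> at its step
  \<open>j\<close>, so it is not delayed. For all \<open>n\<close> gradients to be applied, the
  updates must run \<open>d\<close> steps past the last counted round.\<close>

lemma delayed_linear_regret:
  assumes w: "w 0 \<in> W" and u: "u \<in> W" and G: "0 \<le> G"
    and g: "\<And>j. j < n \<Longrightarrow> dual_norm N (g j) \<le> G"
    and up: "\<And>j. j < n + d \<Longrightarrow>
      md_update D \<psi> W \<eta> (w j) (if d \<le> j then g (j - d) else 0) (w (Suc j))"
    and move: "\<And>v g v'. v \<in> W \<Longrightarrow> dual_norm N g \<le> G \<Longrightarrow> md_update D \<psi> W \<eta> v g v' \<Longrightarrow>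
      N (v' - v) \<le> \<Psi>"
  shows "(\<Sum>j<n. g j \<bullet> (w j - u))
    \<le> B\<^sup>2 / \<eta> + \<eta> * real n * (G\<^sup>2 / 2) + real n * real d * G * \<Psi>"
proof -
  have in_W: "w j \<in> W" if "j \<le> n + d" for j
    using that w by (cases j) (auto intro: md_update_in[OF up])
  have grad: "dual_norm N (if d \<le> j then g (j - d) else 0) \<le> G" if "j < n + d" for j
    using that g G dual_norm_zero[OF norm] by auto
  have step: "N (w j - w (Suc j)) \<le> \<Psi>" if "j < n + d" for j
  proof -
    have "N (w j - w (Suc j)) = N (w (Suc j) - w j)"
      by (rule is_norm_minus_commute[OF norm])
    also have "\<dots> \<le> \<Psi>"
      using move[OF in_W grad up] that by simp
    finally show ?thesis .
  qed
  have drift: "N (w j - w (j + k)) \<le> real k * \<Psi>" if "j < n" "k \<le> d" for j k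
    using that
  proof (induction k)
    case 0
    then show ?case
      by (simp add: is_norm_zero[OF norm])
  next
    case (Suc k)
    have "N (w j - w (j + Suc k)) = N ((w j - w (j + k)) + (w (j + k) - w (Suc (j + k))))"
      by simp
    also have "\<dots> \<le> N (w j - w (j + k)) + N (w (j + k) - w (Suc (j + k)))"
      by (rule is_norm_triangle[OF norm])
    also have "\<dots> \<le> real k * \<Psi> + \<Psi>"
      using Suc by (intro add_mono step) auto
    finally show ?case
      by (simp add: algebra_simps)
  qed
  have "g j \<bullet> (w j - w (j + d)) \<le> real d * G * \<Psi>" if "j < n" for j
  proof -
    have "g j \<bullet> (w j - w (j + d)) \<le> dual_norm N (g j) * N (w j - w (j + d))"
      by (rule inner_le_dual_norm[OF norm])
    also have "\<dots> \<le> G * (real d * \<Psi>)"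
      using that norm G by (intro mult_mono g drift) (auto simp: is_norm_nonneg)
    finally show ?thesis
      by (simp add: mult_ac)
  qed
  then have "(\<Sum>j<n. g j \<bullet> (w j - w (j + d))) \<le> real n * (real d * G * \<Psi>)"
    using sum_bounded_above[of "{..<n}" "\<lambda>j. g j \<bullet> (w j - w (j + d))" "real d * G * \<Psi>"] by simp
  moreover have "(\<Sum>j<n. g j \<bullet> (w (j + d) - u)) \<le> B\<^sup>2 / \<eta> + \<eta> * real n * (G\<^sup>2 / 2)"
    using linear_regret[of "\<lambda>j. w (j + d)" u n g] in_W[of d] u g up[of "_ + d"] by simp
  moreover have "(\<Sum>j<n. g j \<bullet> (w j - u))
      = (\<Sum>j<n. g j \<bullet> (w (j + d) - u)) + (\<Sum>j<n. g j \<bullet> (w j - w (j + d)))"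
    by (simp add: sum.distrib[symmetric] inner_diff_right)
  ultimately show ?thesis
    by (simp add: mult_ac)
qed

end

section \<open>Rounds and block permutations\<close>

text \<open>On \<open>S\<close>, the counter \<open>card {s. s < t \<and> s \<in> S}\<close> inverts
  \<open>enumerate S\<close>. This links the counters in \<open>dpmd_prediction\<close> to the
  enumerations \<open>T_1\<close> and \<open>T_2\<close>.\<close>

lemma sum_enumerate:
  fixes S :: "nat set" and X :: "nat \<Rightarrow> nat \<Rightarrow> 'b::comm_monoid_add"
  assumes "infinite S"
  shows "(\<Sum>t | t < T \<and> t \<in> S. X t (card {s. s < t \<and> s \<in> S}))
    = (\<Sum>j<card {t. t < T \<and> t \<in> S}. X (enumerate S j) j)"
proof -
  let ?e = "enumerate S"
  have less: "?e i < ?e j \<longleftrightarrow> i < j" for i j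
    using strict_mono_enumerate[OF assms] by (simp add: strict_mono_less)
  have inj: "inj_on ?e A" for A
    using inj_on_subset[OF strict_mono_imp_inj_on[OF strict_mono_enumerate[OF assms]] subset_UNIV] .
  \<comment> \<open>Used twice: with an enumerated element as \<open>b\<close> to evaluate the
    counter, and with \<open>b = T\<close> to cover the index range.\<close>
  have initial: "{s. s < b \<and> s \<in> S} = ?e ` {..<j}" if "\<And>i. ?e i < b \<longleftrightarrow> i < j" for b j
  proof (intro equalityI subsetI)
    fix s assume s: "s \<in> {s. s < b \<and> s \<in> S}"
    then have "s \<in> range ?e"
      unfolding range_enumerate[OF assms] by simp
    with s that show "s \<in> ?e ` {..<j}"
      by auto
  next
    fix s assume "s \<in> ?e ` {..<j}"
    with that show "s \<in> {s. s < b \<and> s \<in> S}"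
      using enumerate_in_set[OF assms] by auto
  qed
  have count: "card {s. s < ?e j \<and> s \<in> S} = j" for j
    by (simp add: initial[OF less] card_image inj)
  have "?e ` {..<card {t. t < T \<and> t \<in> S}} = {t. t < T \<and> t \<in> S}"
  proof -
    define n where "n = (LEAST n. T \<le> ?e n)"
    have "T \<le> ?e T"
      by (rule le_enumerate[OF assms])
    then have "T \<le> ?e n"
      unfolding n_def by (rule LeastI)
    moreover have "?e j < T" if "j < n" for j
      using not_less_Least[of j "\<lambda>n. T \<le> ?e n"] that by (auto simp: n_def)
    ultimately have "?e i < T \<longleftrightarrow> i < n" for i
      using less[of i n] by (metis leD le_less_linear le_less_trans order_le_less_trans)
    then have "{t. t < T \<and> t \<in> S} = ?e ` {..<n}"
      by (rule initial)
    then show ?thesis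
      by (simp add: card_image inj)
  qed
  then have "(\<Sum>t | t < T \<and> t \<in> S. X t (card {s. s < t \<and> s \<in> S}))
      = (\<Sum>t\<in>?e ` {..<card {t. t < T \<and> t \<in> S}}. X t (card {s. s < t \<and> s \<in> S}))"
    by simp
  also have "\<dots> = (\<Sum>j<card {t. t < T \<and> t \<in> S}. X (?e j) j)"
    by (simp add: sum.reindex inj count)
  finally show ?thesis .
qed

text \<open>\<open>enumerate\<close> is strictly increasing throughout only on infinite sets, so the
  enumerated rounds continue beyond the horizon; \<open>first_rounds_less\<close> brings them back
  below it.\<close>

lemma infinite_mod_less:
  fixes M k :: nat
  assumes "0 < k" "0 < M"
  shows "infinite {t. t mod M < k}"
proof -
  have "range (\<lambda>i. i * M) \<subseteq> {t. t mod M < k}"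
    using assms by auto
  moreover have "inj (\<lambda>i. i * M)"
    using assms by (auto intro: injI)
  ultimately show ?thesis
    using finite_subset range_inj_infinite by blast
qed

lemma card_mod_less:
  fixes M k :: nat
  assumes "k \<le> M"
  shows "card {t. t < K * M \<and> t mod M < k} = K * k"
proof (induction K)
  case (Suc K)
  have "{t. t < Suc K * M \<and> t mod M < k}
      = {t. t < K * M \<and> t mod M < k} \<union> (\<lambda>i. K * M + i) ` {..<k}" (is "?A = ?B \<union> ?C")
  proof (rule set_eqI)
    fix t
    show "t \<in> ?A \<longleftrightarrow> t \<in> ?B \<union> ?C"
    proof (cases "t < K * M")
      case False
      then obtain i where i: "t = K * M + i"
        by (metis le_add_diff_inverse not_less)
      then show ?thesis
        using assms by auto
    qed auto
  qed
  moreover have "card (?B \<union> ?C) = card ?B + card ?C"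
    by (rule card_Un_disjoint) auto
  ultimately show ?case
    using Suc by (simp add: card_image)
qed simp

lemma first_rounds_mod:
  assumes "0 < k" "0 < M"
  shows "first_rounds M k j mod M < k"
  using enumerate_in_set[OF infinite_mod_less[OF assms]] by (simp add: first_rounds_def)

lemma first_rounds_mono:
  assumes "0 < k" "0 < M" "i < j"
  shows "first_rounds M k i < first_rounds M k j"
  using strict_mono_enumerate[OF infinite_mod_less[OF assms(1,2)]] assms(3)
  by (auto simp: first_rounds_def strict_mono_def)

text \<open>Counting: otherwise all \<open>K * k\<close> such rounds below \<open>K * M\<close>
  would have an index below \<open>j\<close>, although \<open>j < K * k\<close>.\<close>

lemma first_rounds_less:
  fixes M k :: nat
  assumes "0 < k" "k \<le> M" "j < K * k"
  shows "first_rounds M k j < K * M"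
proof (rule ccontr)
  let ?S = "{t. t mod M < k}"
  assume "\<not> first_rounds M k j < K * M"
  then have sub: "{t. t < K * M \<and> t mod M < k} \<subseteq> first_rounds M k ` {..<j}"
  proof safe
    fix t
    assume t: "t < K * M" "t mod M < k" and j: "\<not> first_rounds M k j < K * M"
    have inf: "infinite ?S"
      using assms by (intro infinite_mod_less) auto
    have "t \<in> range (first_rounds M k)"
      using range_enumerate[OF inf] t(2) by (simp add: first_rounds_def)
    then obtain i where i: "first_rounds M k i = t"
      by blast
    have "i < j"
    proof (rule ccontr)
      assume "\<not> i < j"
      then have "first_rounds M k j \<le> first_rounds M k i"
        using first_rounds_mono[of k M j i] assms by (cases "i = j") auto
      with i t(1) j show False
        by simp
    qed
    then show "t \<in> first_rounds M k ` {..<j}"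
      using i by blast
  qed
  have "K * k \<le> card (first_rounds M k ` {..<j})"
    using card_mono[OF _ sub] card_mod_less[OF assms(2), of K] by simp
  also have "\<dots> \<le> j"
    using card_image_le[of "{..<j}" "first_rounds M k"] by simp
  finally show False
    using assms by simp
qed

lemma sum_first_rounds:
  fixes M k :: nat and X :: "nat \<Rightarrow> nat \<Rightarrow> 'b::comm_monoid_add"
  assumes "0 < k" "k \<le> M"
  shows "(\<Sum>t | t < K * M \<and> t mod M < k. X t (card {s. s < t \<and> s mod M < k}))
    = (\<Sum>j<K * k. X (first_rounds M k j) j)"
  using sum_enumerate[where S = "{t. t mod M < k}" and T = "K * M" and X = X] infinite_mod_less[of k M] assms
    card_mod_less[OF assms(2), of K]
  by (simp add: first_rounds_def)

lemma mod_add_less: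
  fixes t M d :: nat
  assumes "t mod M < M - d"
  shows "(t + d) mod M = t mod M + d" "(t + d) div M = t div M"
proof -
  have *: "t + d = t div M * M + (t mod M + d)"
    by simp
  have **: "t mod M + d < M"
    using assms by simp
  show "(t + d) mod M = t mod M + d"
    using ** by (subst *) (simp only: mod_mult_self3 mod_less)
  show "(t + d) div M = t div M"
    using ** by (subst *) (auto simp only: div_mult_self3 div_less)
qed

text \<open>A shift by \<open>d\<close> pairs each slow round with the round of the same block whose
  loss is observed then; this is why \<open>T_2\<close> enumerates the first
  \<open>M - \<tau>\<close> rounds of each block.\<close>

lemma late_rounds_eq_shift:
  fixes M d :: nat
  assumes "0 < M"
  shows "{s. s < a \<and> d \<le> s mod M} = (\<lambda>s. s + d) ` {s. s + d < a \<and> s mod M < M - d}"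
proof (intro equalityI subsetI)
  fix s assume s: "s \<in> {s. s < a \<and> d \<le> s mod M}"
  then have "d \<le> s mod M"
    by simp
  also have "\<dots> \<le> s"
    by simp
  finally have "d \<le> s" .
  have "s - d = s div M * M + (s mod M - d)"
    using s div_mult_mod_eq[of s M] by (simp only: mem_Collect_eq) linarith
  moreover have less: "s mod M - d < M - d"
    using s mod_less_divisor[OF assms, of s] by (intro diff_less_mono) auto
  ultimately have "(s - d) mod M = s mod M - d"
    by simp
  with less have "s - d \<in> {s. s + d < a \<and> s mod M < M - d}"
    using s \<open>d \<le> s\<close> by simp
  then show "s \<in> (\<lambda>s. s + d) ` {s. s + d < a \<and> s mod M < M - d}"
    using \<open>d \<le> s\<close> by force
qed (auto simp: mod_add_less)

lemma sum_late_rounds: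
  fixes M d :: nat and X :: "nat \<Rightarrow> nat \<Rightarrow> 'b::comm_monoid_add"
  assumes "d < M"
  shows "(\<Sum>t | t < K * M \<and> d \<le> t mod M. X t (card {s. s < t \<and> d \<le> s mod M}))
    = (\<Sum>j<K * (M - d). X (first_rounds M (M - d) j + d) j)"
proof -
  have M: "0 < M"
    using assms by simp
  have count: "card {s. s < t + d \<and> d \<le> s mod M} = card {s. s < t \<and> s mod M < M - d}" for t
    by (subst late_rounds_eq_shift[OF M]) (simp add: card_image)
  \<comment> \<open>The horizon is a block boundary, and the shift does not leave the block.\<close>
  have "t + d < K * M \<longleftrightarrow> t < K * M" if "t mod M < M - d" for t
    using mod_add_less(2)[OF that] by (simp only: div_less_iff_less_mult[OF M, symmetric])
  then have "{t. t + d < K * M \<and> t mod M < M - d} = {t. t < K * M \<and> t mod M < M - d}"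
    by blast
  then have "(\<Sum>t | t < K * M \<and> d \<le> t mod M. X t (card {s. s < t \<and> d \<le> s mod M}))
      = (\<Sum>t | t < K * M \<and> t mod M < M - d. X (t + d) (card {s. s < t \<and> s mod M < M - d}))"
    by (simp add: late_rounds_eq_shift[OF M, of "K * M"] sum.reindex count)
  also have "\<dots> = (\<Sum>j<K * (M - d). X (first_rounds M (M - d) j + d) j)"
    using sum_first_rounds[where k = "M - d" and M = M and X = "\<lambda>t. X (t + d)" and K = K] assms by simp
  finally show ?thesis .
qed

section \<open>Block permutations and the exchange of two rounds\<close>

lemma finite_block_perms: "finite (block_perms T M)"
  by (rule finite_subset[OF _ finite_permutations[of "{..<T}"]]) (auto simp: block_perms_def)

lemma id_in_block_perms: "id \<in> block_perms T M"
  by (simp add: block_perms_def permutes_id)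

lemma inv_block_perm_less:
  assumes "\<sigma> \<in> block_perms T M" "t < T"
  shows "inv \<sigma> t < T"
proof -
  have "inv \<sigma> permutes {..<T}"
    using assms(1) by (auto simp: block_perms_def intro: permutes_inv)
  then show ?thesis
    using assms(2) permutes_in_image by fastforce
qed

lemma sum_permuted:
  assumes "\<sigma> \<in> block_perms T M"
  shows "(\<Sum>t<T. permuted h \<sigma> t w) = (\<Sum>t<T. h t w)"
proof -
  have "inv \<sigma> permutes {..<T}"
    using assms by (auto simp: block_perms_def intro: permutes_inv)
  then show ?thesis
    using sum.permute[of "inv \<sigma>" "{..<T}" "\<lambda>t. h t w"] by (simp add: permuted_def o_def)
qed

text \<open>Composition with the transposition is an involution of \<open>block_perms T M\<close>,
  because \<open>a\<close> and \<open>b\<close> share a block. It acts on the left, since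
  permutations send losses to rounds and it is two rounds that are exchanged.\<close>

lemma sum_block_perms_transpose:
  assumes ab: "a < T" "b < T" "a div M = b div M"
  shows "(\<Sum>\<sigma>\<in>block_perms T M. F (Transposition.transpose a b \<circ> \<sigma>)) = (\<Sum>\<sigma>\<in>block_perms T M. F \<sigma>)"
proof (rule sum.reindex_bij_witness[where i = "\<lambda>\<sigma>. Transposition.transpose a b \<circ> \<sigma>"
      and j = "\<lambda>\<sigma>. Transposition.transpose a b \<circ> \<sigma>"])
  have perm: "Transposition.transpose a b permutes {..<T}"
    using ab by (intro permutes_swap_id) auto
  have "Transposition.transpose a b s div M = s div M" for s
    using ab(3) by (auto simp: Transposition.transpose_def)
  then show "Transposition.transpose a b \<circ> \<sigma> \<in> block_perms T M" if "\<sigma> \<in> block_perms T M" for \<sigma>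
    using that perm by (auto simp: block_perms_def intro: permutes_compose)
  then show "Transposition.transpose a b \<circ> \<sigma> \<in> block_perms T M" if "\<sigma> \<in> block_perms T M" for \<sigma>
    using that .
qed (auto simp: fun_eq_iff)

lemma permuted_transpose:
  assumes "\<sigma> \<in> block_perms T M"
  shows "permuted h (Transposition.transpose a b \<circ> \<sigma>) t = permuted h \<sigma> (Transposition.transpose a b t)"
proof -
  have "bij \<sigma>"
    using assms by (auto simp: block_perms_def intro: permutes_bij)
  then show ?thesis
    by (simp add: permuted_def o_inv_distrib)
qed

lemma slow_pred_cong:
  assumes "\<And>i. i < j \<Longrightarrow> df (first_rounds M (M - d) i) = df' (first_rounds M (M - d) i)"
  shows "slow_pred U df d M j = slow_pred U df' d M j"
  using assms by (induction j) auto

text \<open>A slow predictor depends only on losses of rounds before \<open>a\<close>, so it does not change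
  when the losses of rounds \<open>a\<close> and \<open>a + d\<close> are exchanged.\<close>

lemma sum_slow_exchange:
  fixes h :: "nat \<Rightarrow> 'a::zero \<Rightarrow> real" and T M d j :: nat
  assumes d: "d < M" and T: "T = K * M" and j: "j < K * (M - d)"
  defines "a \<equiv> first_rounds M (M - d) j"
  shows "(\<Sum>\<sigma>\<in>block_perms T M. permuted h \<sigma> (a + d) (slow_pred U (permuted dh \<sigma>) d M j)
        - permuted h \<sigma> (a + d) u)
    = (\<Sum>\<sigma>\<in>block_perms T M. permuted h \<sigma> a (slow_pred U (permuted dh \<sigma>) d M j)
        - permuted h \<sigma> a u)"
proof -
  have a: "a mod M < M - d" "a < T"
    using d j T first_rounds_mod[of "M - d" M j] first_rounds_less[of "M - d" M j K]
    by (auto simp: a_def)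
  note same_block = mod_add_less(2)[OF a(1)]
  have ad: "a + d < T"
    using a(2) d same_block by (simp add: T div_less_iff_less_mult[symmetric])
  have pred: "slow_pred U (permuted dh (Transposition.transpose a (a + d) \<circ> \<sigma>)) d M j
      = slow_pred U (permuted dh \<sigma>) d M j" if "\<sigma> \<in> block_perms T M" for \<sigma>
  proof (rule slow_pred_cong)
    fix i assume "i < j"
    \<comment> \<open>Strictly before both exchanged rounds, so the transposition fixes it.\<close>
    then have "first_rounds M (M - d) i < a"
      using d unfolding a_def by (intro first_rounds_mono) auto
    then show "permuted dh (Transposition.transpose a (a + d) \<circ> \<sigma>) (first_rounds M (M - d) i)
        = permuted dh \<sigma> (first_rounds M (M - d) i)"
      by (simp add: permuted_transpose[OF that])
  qed
  show ?thesis
    \<comment> \<open>Reindexing one sum by the exchange swaps the roles of \<open>a\<close> and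
      \<open>a + d\<close>, while \<open>pred\<close> keeps the predictor.\<close>
    by (subst sum_block_perms_transpose[OF a(2) ad same_block[symmetric], symmetric])
      (auto intro!: sum.cong simp: permuted_transpose pred)
qed

section \<open>Regret of the two predictor sequences\<close>

context mirror_descent
begin

text \<open>Here \<open>f\<close> is any fixed loss sequence; no averaging over permutations takes
  place.\<close>

lemma fast_regret:
  assumes d: "0 < d" "d \<le> M" and zero: "0 \<in> W" and u: "u \<in> W"
    and sub: "\<And>t w. t < K * M \<Longrightarrow> w \<in> W \<Longrightarrow> is_subgradient_on W (f t) w (df t w)"
    and grad: "\<And>t w. t < K * M \<Longrightarrow> w \<in> W \<Longrightarrow> dual_norm N (df t w) \<le> G"
    and G: "0 \<le> G"
    and move: "\<And>v g v'. v \<in> W \<Longrightarrow> dual_norm N g \<le> G \<Longrightarrow> md_update D \<psi> W \<eta> v g v' \<Longrightarrow>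
      N (v' - v) \<le> \<Psi>"
  defines "w \<equiv> fast_pred (md_step D \<psi> W \<eta>) df d M"
  shows "(\<Sum>j<K * d. f (first_rounds M d j) (w j) - f (first_rounds M d j) u)
    \<le> B\<^sup>2 / \<eta> + \<eta> * real (K * d) * (G\<^sup>2 / 2) + real (K * d) * real d * G * \<Psi>"
proof -
  define g where "g j = df (first_rounds M d j) (w j)" for j
  have less: "first_rounds M d j < K * M" if "j < K * d" for j
    using that d by (intro first_rounds_less) auto
  have w_Suc: "w (Suc j) = md_step D \<psi> W \<eta> (w j) (if d \<le> j then g (j - d) else 0)" for j
    by (simp add: w_def g_def)
  \<comment> \<open>Gradients are bounded only at points of \<open>W\<close>, and the one used at
    step \<open>j\<close> was taken at \<open>w (j - d)\<close>. Membership in \<open>W\<close>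
    therefore needs strong induction.\<close>
  have grad': "dual_norm N (if d \<le> j then g (j - d) else 0) \<le> G"
    if "j < K * d + d" "\<And>i. i < j \<Longrightarrow> w i \<in> W" for j
    using that d G by (auto simp: g_def dual_norm_zero[OF norm] intro!: grad less)
  have in_W: "w j \<in> W" if "j \<le> K * d + d" for j
    using that
  proof (induction j rule: less_induct)
    case (less j)
    show ?case
    proof (cases j)
      case 0
      then show ?thesis
        by (simp add: w_def zero)
    next
      case (Suc i)
      then show ?thesis
        unfolding Suc w_Suc using less Suc
        by (intro md_update_in[OF md_update_step] grad') auto
    qed
  qed
  have "(\<Sum>j<K * d. f (first_rounds M d j) (w j) - f (first_rounds M d j) u)
      \<le> (\<Sum>j<K * d. g j \<bullet> (w j - u))"
  proof (rule sum_mono)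
    fix j assume "j \<in> {..<K * d}"
    then have "is_subgradient_on W (f (first_rounds M d j)) (w j) (g j)"
      using in_W[of j] less unfolding g_def by (intro sub) auto
    then show "f (first_rounds M d j) (w j) - f (first_rounds M d j) u \<le> g j \<bullet> (w j - u)"
      using u unfolding is_subgradient_on_def by (auto simp: inner_diff_right)
  qed
  also have "\<dots> \<le> B\<^sup>2 / \<eta> + \<eta> * real (K * d) * (G\<^sup>2 / 2) + real (K * d) * real d * G * \<Psi>"
  proof (rule delayed_linear_regret[OF _ u G])
    show "w 0 \<in> W"
      by (simp add: w_def zero)
    show "dual_norm N (g j) \<le> G" if "j < K * d" for j
      using that in_W[of j] less unfolding g_def by (intro grad) auto
    show "md_update D \<psi> W \<eta> (w j) (if d \<le> j then g (j - d) else 0) (w (Suc j))"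
      if "j < K * d + d" for j
      unfolding w_Suc using that in_W by (intro md_update_step grad') auto
  qed (rule move)
  finally show ?thesis .
qed

text \<open>Each predictor is charged the loss it is updated with, not the one it is played against,
  so this is undelayed mirror descent; the exchange connects it to the actual regret.\<close>

lemma slow_regret:
  assumes d: "d < M" and zero: "0 \<in> W" and u: "u \<in> W"
    and sub: "\<And>t w. t < K * M \<Longrightarrow> w \<in> W \<Longrightarrow> is_subgradient_on W (f t) w (df t w)"
    and grad: "\<And>t w. t < K * M \<Longrightarrow> w \<in> W \<Longrightarrow> dual_norm N (df t w) \<le> G"
  defines "w \<equiv> slow_pred (md_step D \<psi> W \<eta>) df d M"
  shows "(\<Sum>j<K * (M - d). f (first_rounds M (M - d) j) (w j) - f (first_rounds M (M - d) j) u)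
    \<le> B\<^sup>2 / \<eta> + \<eta> * real (K * (M - d)) * (G\<^sup>2 / 2)"
proof -
  define g where "g j = df (first_rounds M (M - d) j) (w j)" for j
  have less: "first_rounds M (M - d) j < K * M" if "j < K * (M - d)" for j
    using that d by (intro first_rounds_less) auto
  have w_Suc: "w (Suc j) = md_step D \<psi> W \<eta> (w j) (g j)" for j
    by (simp add: w_def g_def)
  have in_W: "w j \<in> W" if "j \<le> K * (M - d)" for j
    using that
  proof (induction j)
    case (Suc j)
    then show ?case
      unfolding w_Suc unfolding g_def
      by (intro md_update_in[OF md_update_step] grad less) auto
  qed (simp add: w_def zero)
  have grad': "dual_norm N (g j) \<le> G" if "j < K * (M - d)" for j
    using that in_W[of j] less unfolding g_def by (intro grad) auto
  have "(\<Sum>j<K * (M - d). f (first_rounds M (M - d) j) (w j) - f (first_rounds M (M - d) j) u)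
      \<le> (\<Sum>j<K * (M - d). g j \<bullet> (w j - u))"
  proof (rule sum_mono)
    fix j assume "j \<in> {..<K * (M - d)}"
    then have "is_subgradient_on W (f (first_rounds M (M - d) j)) (w j) (g j)"
      using in_W[of j] less unfolding g_def by (intro sub) auto
    then show "f (first_rounds M (M - d) j) (w j) - f (first_rounds M (M - d) j) u
        \<le> g j \<bullet> (w j - u)"
      using u unfolding is_subgradient_on_def by (auto simp: inner_diff_right)
  qed
  also have "\<dots> \<le> B\<^sup>2 / \<eta> + \<eta> * real (K * (M - d)) * (G\<^sup>2 / 2)"
  proof (rule linear_regret[OF _ u grad'])
    show "w 0 \<in> W"
      by (simp add: w_def zero)
    show "md_update D \<psi> W \<eta> (w j) (g j) (w (Suc j))" if "j < K * (M - d)" for j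
      unfolding w_Suc using that in_W[of j] by (intro md_update_step grad') auto
  qed
  finally show ?thesis .
qed

end

text \<open>The minimizers \<open>wstar \<sigma>\<close> may differ, but they share their total loss, so one fixed
  comparator serves all permutations; the exchange argument needs this.\<close>

lemma sum_permuted_arg_min:
  assumes wstar: "\<forall>\<sigma>\<in>block_perms T M.
      is_arg_min (\<lambda>w. \<Sum>t<T. permuted h \<sigma> t w :: real) (\<lambda>w. w \<in> W) (wstar \<sigma>)"
    and "\<sigma> \<in> block_perms T M"
  shows "(\<Sum>t<T. permuted h \<sigma> t (wstar \<sigma>)) = (\<Sum>t<T. permuted h \<sigma> t (wstar id))"
proof (rule antisym)
  have min: "wstar \<rho> \<in> W" "\<And>v. v \<in> W \<Longrightarrow> (\<Sum>t<T. h t (wstar \<rho>)) \<le> (\<Sum>t<T. h t v)"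
    if "\<rho> \<in> block_perms T M" for \<rho>
    using wstar[rule_format, OF that] unfolding is_arg_min_linorder sum_permuted[OF that] by auto
  show "(\<Sum>t<T. permuted h \<sigma> t (wstar \<sigma>)) \<le> (\<Sum>t<T. permuted h \<sigma> t (wstar id))"
    and "(\<Sum>t<T. permuted h \<sigma> t (wstar id)) \<le> (\<Sum>t<T. permuted h \<sigma> t (wstar \<sigma>))"
    unfolding sum_permuted[OF assms(2)]
    by (intro min assms(2) id_in_block_perms)+
qed

text \<open>The right-hand side is in the form that \<open>fast_regret\<close> and
  \<open>slow_regret\<close> bound for each permutation separately.\<close>

lemma expected_regret_split:
  fixes h :: "nat \<Rightarrow> 'a::real_inner \<Rightarrow> real"
  assumes d: "0 < d" "d < M" and T: "T = K * M"
    and wstar: "\<forall>\<sigma>\<in>block_perms T M.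
      is_arg_min (\<lambda>w. \<Sum>t<T. permuted h \<sigma> t w) (\<lambda>w. w \<in> W) (wstar \<sigma>)"
  shows "dpmd_expected_regret D \<psi> W \<eta>f \<eta>s d M T h dh wstar
    = measure_pmf.expectation (pmf_of_set (block_perms T M)) (\<lambda>\<sigma>.
        (\<Sum>j<K * d. permuted h \<sigma> (first_rounds M d j)
              (fast_pred (md_step D \<psi> W \<eta>f) (permuted dh \<sigma>) d M j)
            - permuted h \<sigma> (first_rounds M d j) (wstar id))
        + (\<Sum>j<K * (M - d). permuted h \<sigma> (first_rounds M (M - d) j)
              (slow_pred (md_step D \<psi> W \<eta>s) (permuted dh \<sigma>) d M j)
            - permuted h \<sigma> (first_rounds M (M - d) j) (wstar id)))"
proof -
  let ?S = "block_perms T M" and ?u = "wstar id"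
  let ?wf = "\<lambda>\<sigma>. fast_pred (md_step D \<psi> W \<eta>f) (permuted dh \<sigma>) d M"
  let ?ws = "\<lambda>\<sigma>. slow_pred (md_step D \<psi> W \<eta>s) (permuted dh \<sigma>) d M"
  let ?fast = "\<lambda>\<sigma>. \<Sum>j<K * d. permuted h \<sigma> (first_rounds M d j) (?wf \<sigma> j)
    - permuted h \<sigma> (first_rounds M d j) ?u"
  \<comment> \<open>Offset \<open>e = d\<close> is the loss suffered, \<open>e = 0\<close> the loss
    used in the update.\<close>
  let ?slow = "\<lambda>\<sigma> e j. permuted h \<sigma> (first_rounds M (M - d) j + e) (?ws \<sigma> j)
    - permuted h \<sigma> (first_rounds M (M - d) j + e) ?u"
  have split: "(\<Sum>t<T. permuted h \<sigma> t
        (dpmd_prediction D \<psi> W \<eta>f \<eta>s d M (permuted dh \<sigma>) t) - permuted h \<sigma> t (wstar \<sigma>))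
      = ?fast \<sigma> + (\<Sum>j<K * (M - d). ?slow \<sigma> d j)" (is "?lhs = _") if "\<sigma> \<in> ?S" for \<sigma>
  proof -
    let ?X = "\<lambda>t. permuted h \<sigma> t (dpmd_prediction D \<psi> W \<eta>f \<eta>s d M (permuted dh \<sigma>) t)
      - permuted h \<sigma> t ?u"
    \<comment> \<open>The comparator is replaced in the total over all rounds, before the split:
      equality of the minimizers' losses is known only for that total.\<close>
    have "?lhs = (\<Sum>t<T. ?X t)"
      by (simp add: sum_subtractf sum_permuted_arg_min[OF wstar that])
    also have "\<dots> = sum ?X ({t. t < T \<and> t mod M < d} \<union> {t. t < T \<and> d \<le> t mod M})"
      by (rule sum.cong) auto
    also have "\<dots> = sum ?X {t. t < T \<and> t mod M < d} + sum ?X {t. t < T \<and> d \<le> t mod M}"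
      by (rule sum.union_disjoint) auto
    also have "sum ?X {t. t < T \<and> t mod M < d} = ?fast \<sigma>"
      using sum_first_rounds[where k = d and M = M and K = K
          and X = "\<lambda>t j. permuted h \<sigma> t (?wf \<sigma> j) - permuted h \<sigma> t ?u"] d
      by (simp add: dpmd_prediction_def T)
    also have "sum ?X {t. t < T \<and> d \<le> t mod M} = (\<Sum>j<K * (M - d). ?slow \<sigma> d j)"
      using sum_late_rounds[where d = d and M = M and K = K
          and X = "\<lambda>t j. permuted h \<sigma> t (?ws \<sigma> j) - permuted h \<sigma> t ?u"] d
      by (simp add: dpmd_prediction_def T)
    finally show ?thesis .
  qed
  have exchange: "(\<Sum>\<sigma>\<in>?S. \<Sum>j<K * (M - d). ?slow \<sigma> d j)
      = (\<Sum>\<sigma>\<in>?S. \<Sum>j<K * (M - d). ?slow \<sigma> 0 j)"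
  proof -
    \<comment> \<open>The sum over \<open>j\<close> moves outside because each \<open>j\<close> has
      its own transposition.\<close>
    have "(\<Sum>\<sigma>\<in>?S. \<Sum>j<K * (M - d). ?slow \<sigma> d j)
        = (\<Sum>j<K * (M - d). \<Sum>\<sigma>\<in>?S. ?slow \<sigma> d j)"
      by (rule sum.swap)
    also have "\<dots> = (\<Sum>j<K * (M - d). \<Sum>\<sigma>\<in>?S. ?slow \<sigma> 0 j)"
      by (rule sum.cong[OF refl]) (simp add: sum_slow_exchange[OF d(2) T])
    also have "\<dots> = (\<Sum>\<sigma>\<in>?S. \<Sum>j<K * (M - d). ?slow \<sigma> 0 j)"
      by (rule sum.swap)
    finally show ?thesis .
  qed
  have "?S \<noteq> {}"
    using id_in_block_perms by blast
  moreover have "(\<Sum>\<sigma>\<in>?S. \<Sum>t<T. permuted h \<sigma> t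
        (dpmd_prediction D \<psi> W \<eta>f \<eta>s d M (permuted dh \<sigma>) t) - permuted h \<sigma> t (wstar \<sigma>))
      = (\<Sum>\<sigma>\<in>?S. ?fast \<sigma> + (\<Sum>j<K * (M - d). ?slow \<sigma> 0 j))"
  proof (subst sum.cong[OF refl split])
    show "(\<Sum>\<sigma>\<in>?S. ?fast \<sigma> + (\<Sum>j<K * (M - d). ?slow \<sigma> d j))
        = (\<Sum>\<sigma>\<in>?S. ?fast \<sigma> + (\<Sum>j<K * (M - d). ?slow \<sigma> 0 j))"
      by (simp only: sum.distrib exchange)
  qed
  ultimately show ?thesis
    unfolding dpmd_expected_regret_def integral_pmf_of_set[OF \<open>?S \<noteq> {}\<close> finite_block_perms]
    by simp
qed

section \<open>Tuned step sizes\<close>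

text \<open>This step size balances the two terms: each equals \<open>b * g * sqrt (r / q)\<close>.
  Hence the factor 2 in the tuned bound.\<close>

lemma tuned_step_size:
  fixes b g q r :: real
  assumes "0 < b" "0 < g" "0 < q" "0 < r"
  defines "\<eta> \<equiv> b * sqrt q / (g * sqrt r)"
  shows "b\<^sup>2 / \<eta> + \<eta> * (r / q) * g\<^sup>2 = 2 * (b * g * sqrt (r / q))"
proof -
  have q: "q = sqrt q * sqrt q" and r: "r = sqrt r * sqrt r"
    using assms by simp_all
  have "b\<^sup>2 / \<eta> = b * g * (sqrt r / sqrt q)"
    using assms by (simp add: \<eta>_def field_simps power2_eq_square)
  moreover have "\<eta> * (r / q) * g\<^sup>2 = b * g * (sqrt r / sqrt q)"
    unfolding \<eta>_def using assms
    by (subst (2) q, subst (2) r) (simp add: field_simps power2_eq_square)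
  ultimately show ?thesis
    by (simp add: real_sqrt_divide)
qed

text \<open>Positivity of \<open>G\<close>, \<open>B\<close> and
  \<open>1 / 2 + c * real \<tau>\<close> is recovered from positivity of the step sizes, using
  \<open>x / 0 = 0\<close> and the fact that \<open>sqrt\<close> is odd on the reals.\<close>

lemma tuned_regret_bound:
  fixes B G \<eta>f \<eta>s \<Psi> c :: real and T \<tau> M :: nat
  assumes params: "1 \<le> \<tau>" "\<tau> < M" "M \<le> T"
    and pos: "0 < \<eta>f" "0 < \<eta>s" "0 \<le> G"
    and \<Psi>: "\<Psi> \<le> c * \<eta>f * G"
    and \<eta>f: "\<eta>f = B * sqrt (real M) / (G * sqrt (real T * real \<tau> * (1 / 2 + c * real \<tau>)))"
    and \<eta>s: "\<eta>s = B * sqrt (2 * real M) / (G * sqrt (real T * (real M - real \<tau>)))"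
  shows "B\<^sup>2 / \<eta>f + \<eta>f * (real T * real \<tau> / real M) * (G\<^sup>2 / 2)
         + real T * (real \<tau>)\<^sup>2 / real M * G * \<Psi>
         + B\<^sup>2 / \<eta>s + \<eta>s * (real T * (real M - real \<tau>) / real M) * (G\<^sup>2 / 2)
       \<le> tuned_bound 2 c B G T \<tau> M"
    and "2 \<le> c \<Longrightarrow> tuned_bound 2 c B G T \<tau> M \<le> tuned_bound c c B G T \<tau> M"
proof -
  have nat: "0 < real \<tau>" "0 < real M" "0 < real T" "0 < real M - real \<tau>"
    using params by auto
  define r where "r = real T * real \<tau> * (1 / 2 + c * real \<tau>)"
  define q where "q = real T * (real M - real \<tau>)"
  have q: "0 < q"
    using nat by (simp add: q_def)
  have "G \<noteq> 0"
  proof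
    assume "G = 0"
    then have "\<eta>s = 0"
      unfolding \<eta>s by simp
    with pos show False
      by simp
  qed
  with pos have G: "0 < G"
    by simp
  have "0 < sqrt (2 * real M) / (G * sqrt q)"
    using nat q G by simp
  moreover have "\<eta>s = B * (sqrt (2 * real M) / (G * sqrt q))"
    by (simp add: \<eta>s q_def)
  ultimately have B: "0 < B"
    using pos(2) by (simp only: zero_less_mult_pos2)
  have r: "0 < r"
  proof (rule ccontr)
    assume "\<not> 0 < r"
    then have "G * sqrt r \<le> 0"
      using G by (simp add: mult_nonneg_nonpos)
    moreover have "0 \<le> B * sqrt (real M)"
      using B by simp
    ultimately have "\<eta>f \<le> 0"
      unfolding \<eta>f r_def[symmetric] by (rule divide_nonneg_nonpos[rotated])
    with pos show False
      by simp
  qed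
  then have c: "0 < 1 / 2 + c * real \<tau>"
    using nat zero_less_mult_pos[of "real T * real \<tau>" "1 / 2 + c * real \<tau>"]
    unfolding r_def by simp
  have "real T * (real \<tau>)\<^sup>2 / real M * G * \<Psi> \<le> real T * (real \<tau>)\<^sup>2 / real M * G * (c * \<eta>f * G)"
    using \<Psi> G by (intro mult_left_mono) auto
  \<comment> \<open>Gradient term and delay term are both linear in \<open>\<eta>f\<close>; their
    sum explains the radicand \<open>r\<close> in the step size.\<close>
  moreover have "\<eta>f * (real T * real \<tau> / real M) * (G\<^sup>2 / 2)
      + real T * (real \<tau>)\<^sup>2 / real M * G * (c * \<eta>f * G) = \<eta>f * (r / real M) * G\<^sup>2"
  proof -
    define k where "k = real T * real \<tau> / real M"
    have "r / real M = k * (1 / 2 + c * real \<tau>)" "real T * (real \<tau>)\<^sup>2 / real M = k * real \<tau>"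
      by (simp_all add: r_def k_def power2_eq_square)
    then show ?thesis
      unfolding k_def[symmetric] by (simp add: distrib_left distrib_right power2_eq_square)
  qed
  ultimately have "B\<^sup>2 / \<eta>f + \<eta>f * (real T * real \<tau> / real M) * (G\<^sup>2 / 2)
      + real T * (real \<tau>)\<^sup>2 / real M * G * \<Psi> \<le> B\<^sup>2 / \<eta>f + \<eta>f * (r / real M) * G\<^sup>2"
    by linarith
  also have "\<dots> = 2 * (B * G * sqrt (r / real M))"
    unfolding \<eta>f r_def[symmetric] by (rule tuned_step_size[OF B G nat(2) r])
  also have "sqrt (r / real M) = sqrt (real T * real \<tau> / real M) * sqrt (1 / 2 + c * real \<tau>)"
    unfolding real_sqrt_mult[symmetric] by (simp add: r_def)
  finally have fast: "B\<^sup>2 / \<eta>f + \<eta>f * (real T * real \<tau> / real M) * (G\<^sup>2 / 2)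
      + real T * (real \<tau>)\<^sup>2 / real M * G * \<Psi>
      \<le> 2 * sqrt (real T * real \<tau> / real M) * (B * G * sqrt (1 / 2 + c * real \<tau>))"
    by (simp add: mult_ac)
  \<comment> \<open>The 1/2 moves into the denominator, which becomes the \<open>2 * real M\<close>
    of the step size. The factor 2 from balancing is later absorbed under the root as 4.\<close>
  have "\<eta>s * (q / real M) * (G\<^sup>2 / 2) = \<eta>s * (q / (2 * real M)) * G\<^sup>2"
    by simp
  then have "B\<^sup>2 / \<eta>s + \<eta>s * (q / real M) * (G\<^sup>2 / 2)
      = B\<^sup>2 / \<eta>s + \<eta>s * (q / (2 * real M)) * G\<^sup>2"
    by (rule arg_cong)
  also have "\<dots> = 2 * (B * G * sqrt (q / (2 * real M)))"
    unfolding \<eta>s q_def[symmetric] using nat by (intro tuned_step_size[OF B G _ q]) simp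
  also have "\<dots> = B * G * (sqrt (2\<^sup>2) * sqrt (q / (2 * real M)))"
    by simp
  also have "\<dots> = B * G * sqrt (2\<^sup>2 * (q / (2 * real M)))"
    by (simp only: real_sqrt_mult)
  also have "2\<^sup>2 * (q / (2 * real M)) = 2 * real T * (real M - real \<tau>) / real M"
    by (simp add: q_def)
  also have "B * G * sqrt \<dots> = sqrt \<dots> * (B * G)"
    by (rule mult.commute)
  finally have "B\<^sup>2 / \<eta>s + \<eta>s * (q / real M) * (G\<^sup>2 / 2)
      = sqrt (2 * real T * (real M - real \<tau>) / real M) * (B * G)" .
  with fast have "B\<^sup>2 / \<eta>f + \<eta>f * (real T * real \<tau> / real M) * (G\<^sup>2 / 2)
         + real T * (real \<tau>)\<^sup>2 / real M * G * \<Psi>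
         + (B\<^sup>2 / \<eta>s + \<eta>s * (q / real M) * (G\<^sup>2 / 2)) \<le> tuned_bound 2 c B G T \<tau> M"
    unfolding tuned_bound_def by linarith
  then show "B\<^sup>2 / \<eta>f + \<eta>f * (real T * real \<tau> / real M) * (G\<^sup>2 / 2)
         + real T * (real \<tau>)\<^sup>2 / real M * G * \<Psi>
         + B\<^sup>2 / \<eta>s + \<eta>s * (real T * (real M - real \<tau>) / real M) * (G\<^sup>2 / 2)
       \<le> tuned_bound 2 c B G T \<tau> M"
    unfolding q_def by linarith
  show "tuned_bound 2 c B G T \<tau> M \<le> tuned_bound c c B G T \<tau> M" if "2 \<le> c"
    unfolding tuned_bound_def using that B G c by (intro add_right_mono mult_right_mono) auto
qed

text \<open>With a principal filter the estimate is uniform over all admissible triples, with the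
  explicit constant \<open>A + A'\<close>. Absolute values appear because \<open>k\<close>,
  \<open>c\<close>, \<open>B\<close> and \<open>G\<close> are arbitrary reals.\<close>

lemma tuned_bound_bigo:
  "(\<lambda>(T, \<tau>, M). tuned_bound k c B G T \<tau> M)
    \<in> O[principal {(T, \<tau>, M). 1 \<le> \<tau> \<and> \<tau> < M \<and> M \<le> T \<and> M dvd T}](\<lambda>(T, \<tau>, M).
         sqrt (real T) * (sqrt ((real \<tau>)\<^sup>2 / real M) + 1))"
proof -
  define A where "A = \<bar>k\<bar> * \<bar>B * G\<bar> * sqrt (1 / 2 + \<bar>c\<bar>)"
  define A' where "A' = sqrt 2 * \<bar>B * G\<bar>"
  have "\<bar>tuned_bound k c B G T \<tau> M\<bar>
      \<le> (A + A') * \<bar>sqrt (real T) * (sqrt ((real \<tau>)\<^sup>2 / real M) + 1)\<bar>"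
    if params: "1 \<le> \<tau>" "\<tau> < M" for T \<tau> M :: nat
  proof -
    let ?s = "sqrt (real T)" and ?p = "sqrt ((real \<tau>)\<^sup>2 / real M)"
    have abs_sqrt: "sqrt \<bar>x\<bar> = \<bar>sqrt x\<bar>" for x
      by (cases "0 \<le> x") (simp_all add: real_sqrt_minus abs_if)
    have \<tau>: "1 \<le> real \<tau>" and M: "0 < real M"
      using params by auto
    have "\<bar>1 / 2 + c * real \<tau>\<bar> \<le> 1 / 2 + \<bar>c\<bar> * real \<tau>"
      using abs_triangle_ineq[of "1 / 2" "c * real \<tau>"] by (simp add: abs_mult)
    \<comment> \<open>\<open>1 \<le> \<tau>\<close> lets the constant 1/2 be multiplied by
      \<open>\<tau>\<close>; the two factors \<open>\<tau>\<close> then form the square under the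
      root.\<close>
    also have "\<dots> \<le> (1 / 2 + \<bar>c\<bar>) * real \<tau>"
      using \<tau> by (simp add: distrib_right)
    finally have "real T * real \<tau> / real M * \<bar>1 / 2 + c * real \<tau>\<bar>
        \<le> real T * real \<tau> / real M * ((1 / 2 + \<bar>c\<bar>) * real \<tau>)"
      by (intro mult_left_mono) auto
    also have "\<dots> = (1 / 2 + \<bar>c\<bar>) * (real T * ((real \<tau>)\<^sup>2 / real M))"
      by (simp add: power2_eq_square)
    finally have "sqrt (real T * real \<tau> / real M * \<bar>1 / 2 + c * real \<tau>\<bar>)
        \<le> sqrt ((1 / 2 + \<bar>c\<bar>) * (real T * ((real \<tau>)\<^sup>2 / real M)))"
      by (rule real_sqrt_le_mono)
    then have "sqrt (real T * real \<tau> / real M) * \<bar>sqrt (1 / 2 + c * real \<tau>)\<bar>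
        \<le> sqrt (1 / 2 + \<bar>c\<bar>) * (?s * ?p)"
      by (simp only: real_sqrt_mult abs_sqrt)
    then have "\<bar>k\<bar> * \<bar>B * G\<bar> * (sqrt (real T * real \<tau> / real M) * \<bar>sqrt (1 / 2 + c * real \<tau>)\<bar>)
        \<le> \<bar>k\<bar> * \<bar>B * G\<bar> * (sqrt (1 / 2 + \<bar>c\<bar>) * (?s * ?p))"
      by (intro mult_left_mono) auto
    then have fast: "\<bar>k * sqrt (real T * real \<tau> / real M) * (B * G * sqrt (1 / 2 + c * real \<tau>))\<bar>
        \<le> A * (?s * ?p)"
      by (simp add: A_def abs_mult mult_ac)
    have "2 * real T * (real M - real \<tau>) / real M \<le> 2 * real T"
      using M by (simp add: field_simps)
    then have "sqrt (2 * real T * (real M - real \<tau>) / real M) \<le> sqrt 2 * ?s"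
      by (metis real_sqrt_le_mono real_sqrt_mult)
    then have "sqrt (2 * real T * (real M - real \<tau>) / real M) * \<bar>B * G\<bar> \<le> sqrt 2 * ?s * \<bar>B * G\<bar>"
      by (rule mult_right_mono) simp
    moreover have "0 \<le> sqrt (2 * real T * (real M - real \<tau>) / real M)"
      using params by simp
    ultimately have slow: "\<bar>sqrt (2 * real T * (real M - real \<tau>) / real M) * (B * G)\<bar> \<le> A' * ?s"
      by (simp add: A'_def abs_mult mult_ac)
    have "0 \<le> A" "0 \<le> A'"
      by (simp_all add: A_def A'_def)
    then have "A * (?s * ?p) + A' * ?s \<le> (A + A') * (?s * (?p + 1))"
      by (simp add: algebra_simps)
    moreover have "\<bar>tuned_bound k c B G T \<tau> M\<bar> \<le> A * (?s * ?p) + A' * ?s"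
      unfolding tuned_bound_def using fast slow by linarith
    ultimately show ?thesis
      by simp
  qed
  then show ?thesis
    by (intro bigoI[of _ "A + A'"]) (auto simp: eventually_principal)
qed

text \<open>\<open>0 \<in> W\<close> is the common starting point of both sequences.
  \<open>updates_exist\<close> stands for the existence of the intermediate point and of its Bregman
  projection; \<open>W\<close> is not assumed closed.\<close>

theorem theorem1:
  fixes N :: "real ^ 'n \<Rightarrow> real"
    and D W :: "(real ^ 'n) set"
    and \<psi> :: "real ^ 'n \<Rightarrow> real"
    and h :: "nat \<Rightarrow> real ^ 'n \<Rightarrow> real"
    and dh :: "nat \<Rightarrow> real ^ 'n \<Rightarrow> real ^ 'n"
    and wstar :: "(nat \<Rightarrow> nat) \<Rightarrow> real ^ 'n"
    and T \<tau> M :: nat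
    and B G \<eta>f \<eta>s \<Psi> :: real
  assumes norm: "is_norm N"
    and params: "1 \<le> \<tau>" "\<tau> < M" "M \<le> T" "M dvd T"
    and step_sizes: "0 < \<eta>f" "0 < \<eta>s"
    and W: "convex W" "0 \<in> W" "W \<subseteq> D"
    and psi: "mirror_map D \<psi>" "one_strongly_convex_on N W \<psi>"
    and bregman_bound: "\<forall>w\<in>W. \<forall>v\<in>W. bregman \<psi> w v \<le> B\<^sup>2"
    and losses_convex: "\<forall>t<T. convex_on W (h t)"
    and subgradients: "\<forall>t<T. \<forall>w\<in>W. is_subgradient_on W (h t) w (dh t w)"
    and gradient_bound: "\<forall>t<T. \<forall>w\<in>W. dual_norm N (dh t w) \<le> G"
    and updates_exist:
      "\<forall>\<eta>\<in>{\<eta>f, \<eta>s}. \<forall>w\<in>W. \<forall>g. dual_norm N g \<le> G \<longrightarrow> (\<exists>w'. md_update D \<psi> W \<eta> w g w')"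
    and wstar:
      "\<forall>\<sigma>\<in>block_perms T M.
         is_arg_min (\<lambda>w. \<Sum>t<T. permuted h \<sigma> t w) (\<lambda>w. w \<in> W) (wstar \<sigma>)"
    and Psi:
      "\<forall>w\<in>W. \<forall>g w'. dual_norm N g \<le> G \<and> md_update D \<psi> W \<eta>f w g w' \<longrightarrow> N (w' - w) \<le> \<Psi>"
  shows
    "dpmd_expected_regret D \<psi> W \<eta>f \<eta>s \<tau> M T h dh wstar
       \<le> B\<^sup>2 / \<eta>f + \<eta>f * (real T * real \<tau> / real M) * (G\<^sup>2 / 2)
         + real T * (real \<tau>)\<^sup>2 / real M * G * \<Psi>
         + B\<^sup>2 / \<eta>s + \<eta>s * (real T * (real M - real \<tau>) / real M) * (G\<^sup>2 / 2)
     \<and> (\<forall>c::real.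
          \<Psi> \<le> c * \<eta>f * G
          \<and> \<eta>f = B * sqrt (real M) / (G * sqrt (real T * real \<tau> * (1 / 2 + c * real \<tau>)))
          \<and> \<eta>s = B * sqrt (2 * real M) / (G * sqrt (real T * (real M - real \<tau>)))
          \<longrightarrow> dpmd_expected_regret D \<psi> W \<eta>f \<eta>s \<tau> M T h dh wstar \<le> tuned_bound 2 c B G T \<tau> M
            \<and> (2 \<le> c \<longrightarrow>
                dpmd_expected_regret D \<psi> W \<eta>f \<eta>s \<tau> M T h dh wstar \<le> tuned_bound c c B G T \<tau> M)
            \<and> (\<forall>k\<in>{2, c}.
                (\<lambda>(T, \<tau>, M). tuned_bound k c B G T \<tau> M)
                  \<in> O[principal {(T, \<tau>, M). 1 \<le> \<tau> \<and> \<tau> < M \<and> M \<le> T \<and> M dvd T}](\<lambda>(T, \<tau>, M).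
                       sqrt (real T) * (sqrt ((real \<tau>)\<^sup>2 / real M) + 1))))"
proof -
  interpret fast: mirror_descent N D W \<psi> \<eta>f B G
    using assms by unfold_locales (auto simp: mirror_map_def)
  interpret slow: mirror_descent N D W \<psi> \<eta>s B G
    using assms by unfold_locales (auto simp: mirror_map_def)
  define K where "K = T div M"
  have T: "T = K * M"
    using params by (simp add: K_def)
  have M: "0 < real M" "0 < T"
    using params by auto
  have G: "0 \<le> G"
    using dual_norm_nonneg[OF norm, of "dh 0 0"] gradient_bound M W(2) by fastforce
  let ?u = "wstar id"
  have u: "?u \<in> W"
    using wstar id_in_block_perms by (auto simp: is_arg_min_def)
  let ?fast = "B\<^sup>2 / \<eta>f + \<eta>f * real (K * \<tau>) * (G\<^sup>2 / 2) + real (K * \<tau>) * real \<tau> * G * \<Psi>"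
  let ?slow = "B\<^sup>2 / \<eta>s + \<eta>s * real (K * (M - \<tau>)) * (G\<^sup>2 / 2)"
  have "block_perms T M \<noteq> {}"
    using id_in_block_perms by blast
  \<comment> \<open>The bound is a constant that dominates the integrand at every permutation in the
    finite support.\<close>
  then have "dpmd_expected_regret D \<psi> W \<eta>f \<eta>s \<tau> M T h dh wstar
      \<le> measure_pmf.expectation (pmf_of_set (block_perms T M)) (\<lambda>\<sigma>. ?fast + ?slow)"
    unfolding expected_regret_split[OF less_le_trans[OF zero_less_one params(1)] params(2) T wstar]
  proof (intro integral_mono_AE)
    show "AE \<sigma> in measure_pmf (pmf_of_set (block_perms T M)).
        (\<Sum>j<K * \<tau>. permuted h \<sigma> (first_rounds M \<tau> j)
              (fast_pred (md_step D \<psi> W \<eta>f) (permuted dh \<sigma>) \<tau> M j)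
            - permuted h \<sigma> (first_rounds M \<tau> j) ?u)
        + (\<Sum>j<K * (M - \<tau>). permuted h \<sigma> (first_rounds M (M - \<tau>) j)
              (slow_pred (md_step D \<psi> W \<eta>s) (permuted dh \<sigma>) \<tau> M j)
            - permuted h \<sigma> (first_rounds M (M - \<tau>) j) ?u)
        \<le> ?fast + ?slow"
      unfolding AE_measure_pmf_iff set_pmf_of_set[OF \<open>block_perms T M \<noteq> {}\<close> finite_block_perms]
    proof (intro ballI add_mono)
      fix \<sigma> assume "\<sigma> \<in> block_perms T M"
      note inv_less = inv_block_perm_less[OF this]
      have sub: "is_subgradient_on W (permuted h \<sigma> t) w (permuted dh \<sigma> t w)"
        and grad: "dual_norm N (permuted dh \<sigma> t w) \<le> G" if "t < K * M" "w \<in> W" for t w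
        using inv_less[of t] that subgradients gradient_bound by (auto simp: permuted_def T)
      show "(\<Sum>j<K * \<tau>. permuted h \<sigma> (first_rounds M \<tau> j)
            (fast_pred (md_step D \<psi> W \<eta>f) (permuted dh \<sigma>) \<tau> M j)
          - permuted h \<sigma> (first_rounds M \<tau> j) ?u) \<le> ?fast"
        by (rule fast.fast_regret[OF _ _ W(2) u sub grad G]) (use params Psi in auto)
      show "(\<Sum>j<K * (M - \<tau>). permuted h \<sigma> (first_rounds M (M - \<tau>) j)
            (slow_pred (md_step D \<psi> W \<eta>s) (permuted dh \<sigma>) \<tau> M j)
          - permuted h \<sigma> (first_rounds M (M - \<tau>) j) ?u) \<le> ?slow"
        by (rule slow.slow_regret[OF params(2) W(2) u sub grad])
    qed
  qed (auto intro!: integrable_measure_pmf_finite simp: finite_block_perms \<open>block_perms T M \<noteq> {}\<close>)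
  also have "\<dots> = ?fast + ?slow"
    by simp
  also have "\<dots> = B\<^sup>2 / \<eta>f + \<eta>f * (real T * real \<tau> / real M) * (G\<^sup>2 / 2)
         + real T * (real \<tau>)\<^sup>2 / real M * G * \<Psi>
         + B\<^sup>2 / \<eta>s + \<eta>s * (real T * (real M - real \<tau>) / real M) * (G\<^sup>2 / 2)"
    using M(1) params(2) by (simp add: T power2_eq_square of_nat_diff)
  finally have regret: "dpmd_expected_regret D \<psi> W \<eta>f \<eta>s \<tau> M T h dh wstar
      \<le> B\<^sup>2 / \<eta>f + \<eta>f * (real T * real \<tau> / real M) * (G\<^sup>2 / 2)
         + real T * (real \<tau>)\<^sup>2 / real M * G * \<Psi>
         + B\<^sup>2 / \<eta>s + \<eta>s * (real T * (real M - real \<tau>) / real M) * (G\<^sup>2 / 2)" .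
  show ?thesis
  proof (intro conjI allI impI ballI)
    fix c :: real
    assume c: "\<Psi> \<le> c * \<eta>f * G
      \<and> \<eta>f = B * sqrt (real M) / (G * sqrt (real T * real \<tau> * (1 / 2 + c * real \<tau>)))
      \<and> \<eta>s = B * sqrt (2 * real M) / (G * sqrt (real T * (real M - real \<tau>)))"
    note tuned = tuned_regret_bound[OF params(1-3) step_sizes G c[THEN conjunct1]
        c[THEN conjunct2, THEN conjunct1] c[THEN conjunct2, THEN conjunct2]]
    show two: "dpmd_expected_regret D \<psi> W \<eta>f \<eta>s \<tau> M T h dh wstar \<le> tuned_bound 2 c B G T \<tau> M"
      using regret tuned(1) by (rule order_trans)
    show "dpmd_expected_regret D \<psi> W \<eta>f \<eta>s \<tau> M T h dh wstar \<le> tuned_bound c c B G T \<tau> M"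
      if "2 \<le> c"
      using two tuned(2)[OF that] by (rule order_trans)
  qed (rule regret tuned_bound_bigo)+
qed

end
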